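(* Let $X=(X(t))_{t\in[0,1]}$ and $Y=(Y(t))_{t\in[0,1]}$ be real-valued stochastic processes on $[0,1]$ defined on the same probability space, with sample paths in $S$, and let $g$ be a positive probability density on $\mathbb{R}$. Let $(X',Y')$ be an independent copy of $(X,Y)$, and let $Y'',Y'''$ be independent copies of $Y$ which are also independent of $X,X',Y,Y'$. Then the distance covariance $d(P_{X,Y},P_X\otimes P_Y)$ of $X$ and $Y$ satisfies $$\begin{aligned} e\cdot d(P_{X,Y},P_X\otimes P_Y)={}&\mathbb{E}\Big[\exp\Big(\int_{[0,1]}\int_{\mathbb{R}}e^{is(X(x)-X'(x))}g(s)\,ds\int_{\mathbb{R}}e^{is(Y(x)-Y'(x))}g(s)\,ds\,dx\Big)\Big]\\ &+\mathbb{E}\Big[\exp\Big(\int_{[0,1]}\int_{\mathbb{R}}e^{is(X(x)-X'(x))}g(s)\,ds\int_{\mathbb{R}}e^{is(Y''(x)-Y'''(x))}g(s)\,ds\,dx\Big)\Big]\\ &-2\,\mathrm{Re}\,\mathbb{E}\Big[\exp\Big(\int_{[0,1]}\int_{\mathbb{R}}e^{is(X(x)-X'(x))}g(s)\,ds\int_{\mathbb{R}}e^{is(Y(x)-Y''(x))}g(s)\,ds\,dx\Big)\Big]. \end{aligned}$$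
   Context: $S$ is a measurable space of real functions on $[0,1]$; $X$, $Y$ are measurable as maps into $S$, with laws $P_X,P_Y$ and joint law $P_{X,Y}$ on $S\times S$; laws on $S$ and $S\times S$ are determined by their finite-dimensional distributions (e.g. continuous or càdlàg paths). The distance covariance is $$d(P_{X,Y},P_X\otimes P_Y)=\sum_{k=1}^\infty \frac{e^{-1}}{k!}\int_{[0,1]^k}\Big[\int_{\mathbb{R}^{2k}}\big|\varphi_{X,Y}(\mathbf{x}_k;\mathbf{s}_k,\mathbf{t}_k)-\varphi_X(\mathbf{x}_k;\mathbf{s}_k)\,\varphi_Y(\mathbf{x}_k;\mathbf{t}_k)\big|^2\prod_{j=1}^k g(s_j)g(t_j)\,d\mathbf{s}_k\,d\mathbf{t}_k\Big]d\mathbf{x}_k ,$$ where $\mathbf{x}_k=(x_1,\dots,x_k)\in[0,1]^k$, $\mathbf{s}_k,\mathbf{t}_k\in\mathbb{R}^k$, $\varphi_X(\mathbf{x}_k;\mathbf{s}_k)=\mathbb{E}[e^{i\sum_{j=1}^k s_jX(x_j)}]$, $\varphi_Y(\mathbf{x}_k;\mathbf{t}_k)=\mathbb{E}[e^{i\sum_{j=1}^k t_jY(x_j)}]$ and $\varphi_{X,Y}(\mathbf{x}_k;\mathbf{s}_k,\mathbf{t}_k)=\mathbb{E}[e^{i\sum_{j=1}^k (s_jX(x_j)+t_jY(x_j))}]$. As is implicit in these formulas, $(\omega,x)\mapsto X(x),Y(x)$ are assumed jointly measurable, so that all integrals are meaningful and Fubini's theorem applies. In each exponent, the $dx$-integral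 is over the product of the two inner $ds$-integrals. *)

theory Defs
  imports "HOL-Probability.Probability"
begin

abbreviation leb01 :: "real measure" where
  "leb01 \<equiv> restrict_space lborel {0..1}"

text \<open>
  A real function on \<open>[0,1]\<close> is encoded as a function on the reals that is
  \<^const>\<open>extensional\<close> on \<open>{0..1}\<close>. Finite-dimensional distributions are indexed by the finite
  sets \<open>J\<close> of evaluation points; for laws on pairs of paths the same \<open>J\<close> is used in both
  components, which loses nothing, since \<open>J\<close> can always be enlarged.
\<close>

definition path_space :: "(real \<Rightarrow> real) measure \<Rightarrow> bool" where
  "path_space S \<longleftrightarrow>
     space S \<subseteq> {0..1} \<rightarrow>\<^sub>E UNIV \<and>
     (\<forall>x\<in>{0..1}. (\<lambda>f. f x) \<in> borel_measurable S) \<and>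
     (\<forall>\<mu> \<nu>. prob_space \<mu> \<longrightarrow> prob_space \<nu> \<longrightarrow> sets \<mu> = sets S \<longrightarrow> sets \<nu> = sets S \<longrightarrow>
        (\<forall>J. finite J \<longrightarrow> J \<subseteq> {0..1} \<longrightarrow>
           distr \<mu> (Pi\<^sub>M J (\<lambda>_. borel)) (\<lambda>f. restrict f J) =
           distr \<nu> (Pi\<^sub>M J (\<lambda>_. borel)) (\<lambda>f. restrict f J)) \<longrightarrow>
        \<mu> = \<nu>) \<and>
     (\<forall>\<mu> \<nu>. prob_space \<mu> \<longrightarrow> prob_space \<nu> \<longrightarrow>
        sets \<mu> = sets (S \<Otimes>\<^sub>M S) \<longrightarrow> sets \<nu> = sets (S \<Otimes>\<^sub>M S) \<longrightarrow>
        (\<forall>J. finite J \<longrightarrow> J \<subseteq> {0..1} \<longrightarrow>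
           distr \<mu> (Pi\<^sub>M J (\<lambda>_. borel) \<Otimes>\<^sub>M Pi\<^sub>M J (\<lambda>_. borel)) (\<lambda>(f, h). (restrict f J, restrict h J)) =
           distr \<nu> (Pi\<^sub>M J (\<lambda>_. borel) \<Otimes>\<^sub>M Pi\<^sub>M J (\<lambda>_. borel)) (\<lambda>(f, h). (restrict f J, restrict h J))) \<longrightarrow>
        \<mu> = \<nu>)"

definition path_process :: "'a measure \<Rightarrow> (real \<Rightarrow> real) measure \<Rightarrow> ('a \<Rightarrow> real \<Rightarrow> real) \<Rightarrow> bool" where
  "path_process M S X \<longleftrightarrow>
     X \<in> M \<rightarrow>\<^sub>M S \<and> (\<lambda>(\<omega>, x). X \<omega> x) \<in> borel_measurable (M \<Otimes>\<^sub>M leb01)"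

definition fdd_char :: "'a measure \<Rightarrow> ('a \<Rightarrow> real \<Rightarrow> real) \<Rightarrow> nat \<Rightarrow> (nat \<Rightarrow> real) \<Rightarrow> (nat \<Rightarrow> real) \<Rightarrow> complex"
  where
  "fdd_char M X k x s = (\<integral>\<omega>. iexp (\<Sum>j=1..k. s j * X \<omega> (x j)) \<partial>M)"

definition fdd_char2 ::
  "'a measure \<Rightarrow> ('a \<Rightarrow> real \<Rightarrow> real) \<Rightarrow> ('a \<Rightarrow> real \<Rightarrow> real) \<Rightarrow> nat \<Rightarrow>
   (nat \<Rightarrow> real) \<Rightarrow> (nat \<Rightarrow> real) \<Rightarrow> (nat \<Rightarrow> real) \<Rightarrow> complex" where
  "fdd_char2 M X Y k x s t = (\<integral>\<omega>. iexp (\<Sum>j=1..k. s j * X \<omega> (x j) + t j * Y \<omega> (x j)) \<partial>M)"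

definition dcov_integral ::
  "'a measure \<Rightarrow> (real \<Rightarrow> real) \<Rightarrow> ('a \<Rightarrow> real \<Rightarrow> real) \<Rightarrow> ('a \<Rightarrow> real \<Rightarrow> real) \<Rightarrow> nat \<Rightarrow> real" where
  "dcov_integral M g X Y k =
     (\<integral>x. (\<integral>(s, t). (cmod (fdd_char2 M X Y k x s t - fdd_char M X k x s * fdd_char M Y k x t))\<^sup>2
                   * (\<Prod>j=1..k. g (s j) * g (t j))
            \<partial>(Pi\<^sub>M {1..k} (\<lambda>_. lborel) \<Otimes>\<^sub>M Pi\<^sub>M {1..k} (\<lambda>_. lborel)))
      \<partial>(Pi\<^sub>M {1..k} (\<lambda>_. leb01)))"

text \<open>The distance covariance \<open>d(P\<^sub>X\<^sub>,\<^sub>Y, P\<^sub>X \<otimes> P\<^sub>Y)\<close>; the series starts at \<open>k = 1\<close>, hence \<^const>\<open>Suc\<close>.\<close>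

definition dcov ::
  "'a measure \<Rightarrow> (real \<Rightarrow> real) \<Rightarrow> ('a \<Rightarrow> real \<Rightarrow> real) \<Rightarrow> ('a \<Rightarrow> real \<Rightarrow> real) \<Rightarrow> real" where
  "dcov M g X Y = (\<Sum>k. exp (-1) / fact (Suc k) * dcov_integral M g X Y (Suc k))"

definition exp_expectation ::
  "'a measure \<Rightarrow> (real \<Rightarrow> real) \<Rightarrow> ('a \<Rightarrow> real \<Rightarrow> real) \<Rightarrow> ('a \<Rightarrow> real \<Rightarrow> real) \<Rightarrow>
   ('a \<Rightarrow> real \<Rightarrow> real) \<Rightarrow> ('a \<Rightarrow> real \<Rightarrow> real) \<Rightarrow> complex" where
  "exp_expectation M g U U' V V' =
     (\<integral>\<omega>. exp (\<integral>x. (\<integral>s. iexp (s * (U \<omega> x - U' \<omega> x)) * complex_of_real (g s) \<partial>lborel) *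
                   (\<integral>s. iexp (s * (V \<omega> x - V' \<omega> x)) * complex_of_real (g s) \<partial>lborel)
              \<partial>leb01) \<partial>M)"

end

theory Submission
  imports Defs
begin

text \<open>
  Expanding the square and using independence turns the squared modulus of
  \<open>\<phi>\<^sub>X\<^sub>Y - \<phi>\<^sub>X \<phi>\<^sub>Y\<close> into a combination of characteristic functions of the pairs
  \<open>(X - X', Y - Y')\<close>, \<open>(X - X', Y'' - Y''')\<close> and \<open>(X - X', Y - Y'')\<close> at the same points
  \<open>x\<^sub>1, \<dots>, x\<^sub>k\<close>. Each of these is an expectation of a product over \<open>j\<close>, so by Fubini the integrals
  over \<open>s\<^sub>j\<close>, \<open>t\<^sub>j\<close> and \<open>x\<^sub>j\<close> factor and leave \<open>E[Z\<^sup>k]\<close>, where \<open>Z\<close> is the exponent of the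
  corresponding term of the formula. Since \<open>|Z| \<le> 1\<close>, summing \<open>E[Z\<^sup>k] / k!\<close> over \<open>k \<ge> 1\<close> gives
  \<open>E[exp Z] - 1\<close>, and the constants \<open>1 + 1 - 2\<close> cancel.
\<close>

section \<open>Fubini for bounded kernels\<close>

text \<open>Since \<open>M\<close> has total mass 1, integrating the norm of the kernel over
  \<open>M\<close> gives at most 1, so \<open>G\<close> dominates and Fubini applies. It is used
  twice: with \<open>q\<close> the pair of frequency vectors and \<open>G\<close> the product
  weight, then with \<open>q\<close> the vector of evaluation points and \<open>G\<close> constant
  1.\<close>

lemma (in prob_space) Fubini_bounded_kernel:
  fixes W :: "'b \<times> 'a \<Rightarrow> complex"
  assumes "sigma_finite_measure Q" and G: "integrable Q G"
    and W[measurable]: "W \<in> borel_measurable (Q \<Otimes>\<^sub>M M)"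
    and bound: "\<And>q \<omega>. q \<in> space Q \<Longrightarrow> \<omega> \<in> space M \<Longrightarrow> norm (W (q, \<omega>)) \<le> 1"
  shows "integrable Q (\<lambda>q. (\<integral>\<omega>. W (q, \<omega>) \<partial>M) * G q)"
    and "(\<integral>q. (\<integral>\<omega>. W (q, \<omega>) \<partial>M) * G q \<partial>Q) = (\<integral>\<omega>. (\<integral>q. W (q, \<omega>) * G q \<partial>Q) \<partial>M)"
proof -
  interpret Q: sigma_finite_measure Q by fact
  interpret pair_sigma_finite Q M ..
  note borel_measurable_integrable[OF G, measurable]
  have W_int: "integrable M (\<lambda>\<omega>. W (q, \<omega>))" if "q \<in> space Q" for q
    using that bound by (intro integrable_const_bound[where B = 1]) auto
  have int: "integrable (Q \<Otimes>\<^sub>M M) (\<lambda>(q, \<omega>). W (q, \<omega>) * G q)"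
  proof (rule Fubini_integrable)
    show "(\<lambda>(q, \<omega>). W (q, \<omega>) * G q) \<in> borel_measurable (Q \<Otimes>\<^sub>M M)"
      by measurable
    show "AE q in Q. integrable M (\<lambda>\<omega>. case (q, \<omega>) of (q, \<omega>) \<Rightarrow> W (q, \<omega>) * G q)"
      using W_int by auto
    have "(\<integral>\<omega>. norm (W (q, \<omega>)) \<partial>M) \<le> 1" if "q \<in> space Q" for q
      using that bound W_int by (intro integral_le_const) auto
    then show "integrable Q (\<lambda>q. \<integral>\<omega>. norm (case (q, \<omega>) of (q, \<omega>) \<Rightarrow> W (q, \<omega>) * G q) \<partial>M)"
      by (intro Bochner_Integration.integrable_bound[OF G])
        (auto simp: norm_mult abs_mult intro!: mult_left_le_one_le)
  qed
  from integrable_fst'[OF int] show "integrable Q (\<lambda>q. (\<integral>\<omega>. W (q, \<omega>) \<partial>M) * G q)"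
    by simp
  from Fubini_integral[OF int]
  show "(\<integral>q. (\<integral>\<omega>. W (q, \<omega>) \<partial>M) * G q \<partial>Q) = (\<integral>\<omega>. (\<integral>q. W (q, \<omega>) * G q \<partial>Q) \<partial>M)"
    by simp
qed

text \<open>Separates the integral over the frequencies of X from the one over the frequencies of
  Y.\<close>

lemma integral_pair_times:
  fixes F H :: "_ \<Rightarrow> complex"
  assumes "sigma_finite_measure M1" "sigma_finite_measure M2"
    and F: "integrable M1 F" and H: "integrable M2 H"
  shows "integrable (M1 \<Otimes>\<^sub>M M2) (\<lambda>(x, y). F x * H y)"
    and "(\<integral>(x, y). F x * H y \<partial>(M1 \<Otimes>\<^sub>M M2)) = integral\<^sup>L M1 F * integral\<^sup>L M2 H"
proof -
  interpret M1: sigma_finite_measure M1 by fact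
  interpret M2: sigma_finite_measure M2 by fact
  interpret pair_sigma_finite M1 M2 ..
  note borel_measurable_integrable[OF F, measurable] borel_measurable_integrable[OF H, measurable]
  show int: "integrable (M1 \<Otimes>\<^sub>M M2) (\<lambda>(x, y). F x * H y)"
    by (rule Fubini_integrable) (auto simp: norm_mult F H intro!: integrable_mult_left F)
  from integral_fst'[OF int]
  show "(\<integral>(x, y). F x * H y \<partial>(M1 \<Otimes>\<^sub>M M2)) = integral\<^sup>L M1 F * integral\<^sup>L M2 H"
    by simp
qed

section \<open>The Fourier transform of the weight\<close>

text \<open>For a probability density \<open>g\<close> this is the characteristic function of the
  law with density \<open>g\<close>. The two inner integrals in each exponent are its values at
  differences of paths.\<close>

definition weight_char :: "(real \<Rightarrow> real) \<Rightarrow> real \<Rightarrow> complex" where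
  "weight_char g u = (\<integral>s. iexp (s * u) * complex_of_real (g s) \<partial>lborel)"

lemma norm_weight_char_le:
  assumes "\<And>s. 0 < g s" and "has_bochner_integral lborel g 1"
  shows "norm (weight_char g u) \<le> 1"
proof -
  have "norm (weight_char g u) \<le> (\<integral>s. norm (iexp (s * u) * complex_of_real (g s)) \<partial>lborel)"
    unfolding weight_char_def by (rule integral_norm_bound)
  also have "\<dots> = (\<integral>s. g s \<partial>lborel)"
    using assms(1) by (simp add: norm_mult less_imp_le)
  also have "\<dots> = 1"
    using assms(2) by (rule has_bochner_integral_integral_eq)
  finally show ?thesis .
qed

lemma borel_measurable_weight_char:
  assumes "g \<in> borel_measurable lborel"
  shows "weight_char g \<in> borel_measurable borel"
proof -
  note assms[measurable]
  show ?thesis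
    unfolding weight_char_def[abs_def] by (rule lborel.borel_measurable_lebesgue_integral) measurable
qed

text \<open>The exponential of a sum and the weight are both products over the coordinates, so the
  integral over all frequencies splits into one-dimensional integrals, each a value of
  \<open>weight_char g\<close>.\<close>

lemma
  fixes g :: "real \<Rightarrow> real" and a b :: "nat \<Rightarrow> real"
  assumes "finite I" and g: "integrable lborel g"
  shows integrable_iexp_weight:
      "integrable (Pi\<^sub>M I (\<lambda>_. lborel) \<Otimes>\<^sub>M Pi\<^sub>M I (\<lambda>_. lborel))
        (\<lambda>(s, t). iexp (\<Sum>j\<in>I. s j * a j + t j * b j) * complex_of_real (\<Prod>j\<in>I. g (s j) * g (t j)))"
      (is "integrable ?Q ?f")
    and integral_iexp_weight:
      "(\<integral>(s, t). iexp (\<Sum>j\<in>I. s j * a j + t j * b j) * complex_of_real (\<Prod>j\<in>I. g (s j) * g (t j))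
          \<partial>(Pi\<^sub>M I (\<lambda>_. lborel) \<Otimes>\<^sub>M Pi\<^sub>M I (\<lambda>_. lborel))) =
        (\<Prod>j\<in>I. weight_char g (a j) * weight_char g (b j))"
proof -
  interpret P: product_sigma_finite "\<lambda>_::nat. lborel :: real measure" ..
  have sf: "sigma_finite_measure (Pi\<^sub>M I (\<lambda>_. lborel :: real measure))"
    using \<open>finite I\<close> by (rule P.sigma_finite)
  define F :: "(nat \<Rightarrow> real) \<Rightarrow> (nat \<Rightarrow> real) \<Rightarrow> complex"
    where "F c s = (\<Prod>j\<in>I. iexp (s j * c j) * complex_of_real (g (s j)))" for c s
  have f_eq: "?f = (\<lambda>(s, t). F a s * F b t)"
    by (auto simp: F_def fun_eq_iff exp_sum[OF \<open>finite I\<close>] prod.distrib sum_distrib_left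
        exp_add ring_distribs of_real_sum of_real_prod)
  have 1: "integrable lborel (\<lambda>s. iexp (s * u) * complex_of_real (g s))" for u
    using g by (intro Bochner_Integration.integrable_bound[OF g]) (auto simp: norm_mult)
  have F_int: "integrable (Pi\<^sub>M I (\<lambda>_. lborel)) (F c)" for c
    unfolding F_def[abs_def] using 1
    by (intro P.product_integrable_prod[OF \<open>finite I\<close>, of "\<lambda>j s. iexp (s * c j) * complex_of_real (g s)"])
  have F_eq: "integral\<^sup>L (Pi\<^sub>M I (\<lambda>_. lborel)) (F c) = (\<Prod>j\<in>I. weight_char g (c j))" for c
    unfolding F_def[abs_def] weight_char_def using 1
    by (intro P.product_integral_prod[OF \<open>finite I\<close>, of "\<lambda>j s. iexp (s * c j) * complex_of_real (g s)"])
  show "integrable ?Q ?f"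
    unfolding f_eq by (rule integral_pair_times[OF sf sf F_int F_int])
  have "integral\<^sup>L ?Q ?f = integral\<^sup>L (Pi\<^sub>M I (\<lambda>_. lborel)) (F a) * integral\<^sup>L (Pi\<^sub>M I (\<lambda>_. lborel)) (F b)"
    unfolding f_eq by (rule integral_pair_times[OF sf sf F_int F_int])
  then show "integral\<^sup>L ?Q ?f = (\<Prod>j\<in>I. weight_char g (a j) * weight_char g (b j))"
    by (simp only: F_eq prod.distrib)
qed

section \<open>Moments of the inner integral\<close>

text \<open>The exponent of the formula, with \<open>D\<close> in the place of X - X' and
  \<open>E\<close> in the place of the difference of the two Y-paths.\<close>

definition path_integral ::
  "(real \<Rightarrow> real) \<Rightarrow> ('a \<Rightarrow> real \<Rightarrow> real) \<Rightarrow> ('a \<Rightarrow> real \<Rightarrow> real) \<Rightarrow> 'a \<Rightarrow> complex" where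
  "path_integral g D E \<omega> = (\<integral>x. weight_char g (D \<omega> x) * weight_char g (E \<omega> x) \<partial>leb01)"

lemma prob_space_leb01: "prob_space leb01"
  by (rule prob_spaceI) (simp add: space_restrict_space emeasure_restrict_space)

lemma (in prob_space)
  fixes D E :: "'a \<Rightarrow> real \<Rightarrow> real"
  assumes D[measurable]: "(\<lambda>(\<omega>, x). D \<omega> x) \<in> borel_measurable (M \<Otimes>\<^sub>M leb01)"
    and E[measurable]: "(\<lambda>(\<omega>, x). E \<omega> x) \<in> borel_measurable (M \<Otimes>\<^sub>M leb01)"
    and g_pos: "\<And>s. 0 < g s" and g_int: "has_bochner_integral lborel g 1"
  shows borel_measurable_path_integral: "path_integral g D E \<in> borel_measurable M"
    and norm_path_integral_le: "\<And>\<omega>. norm (path_integral g D E \<omega>) \<le> 1"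
proof -
  interpret L: prob_space leb01 by (rule prob_space_leb01)
  have [measurable]: "weight_char g \<in> borel_measurable borel"
    using g_int by (intro borel_measurable_weight_char borel_measurable_has_bochner_integral)
  show "path_integral g D E \<in> borel_measurable M"
    unfolding path_integral_def[abs_def] by (rule L.borel_measurable_lebesgue_integral) measurable
  have le: "norm (weight_char g (D \<omega> x) * weight_char g (E \<omega> x)) \<le> 1" for \<omega> x
    using norm_weight_char_le[of g] g_pos g_int by (auto simp: norm_mult intro!: mult_le_one)
  show "norm (path_integral g D E \<omega>) \<le> 1" for \<omega>
  proof -
    have "norm (path_integral g D E \<omega>) \<le>
        (\<integral>x. norm (weight_char g (D \<omega> x) * weight_char g (E \<omega> x)) \<partial>leb01)"
      unfolding path_integral_def by (rule integral_norm_bound)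
    \<comment> \<open>Only the constant majorant has to be integrable here, so the bound also covers
      \<open>\<omega>\<close> outside \<open>space M\<close>, where \<open>D \<omega>\<close> and
      \<open>E \<omega>\<close> need not be measurable.\<close>
    also have "\<dots> \<le> (\<integral>x. 1 \<partial>leb01)"
      using le by (intro integral_mono') auto
    also have "\<dots> = 1"
      using L.prob_space by simp
    finally show ?thesis .
  qed
qed

text \<open>Two exchanges of integrals. For fixed \<open>x\<close> the expectation is taken outside
  the integral over the frequencies, which then factors by \<open>integral_iexp_weight\<close>. Next
  it is taken outside the integral over \<open>x\<close>, where the \<open>k\<close> coordinates
  contribute equal factors and hence a \<open>k\<close>-th power.\<close>

lemma (in prob_space)
  fixes D E :: "'a \<Rightarrow> real \<Rightarrow> real" and k :: nat
  assumes D[measurable]: "(\<lambda>(\<omega>, x). D \<omega> x) \<in> borel_measurable (M \<Otimes>\<^sub>M leb01)"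
    and E[measurable]: "(\<lambda>(\<omega>, x). E \<omega> x) \<in> borel_measurable (M \<Otimes>\<^sub>M leb01)"
    and g_pos: "\<And>s. 0 < g s" and g_int: "has_bochner_integral lborel g 1"
  defines "P \<equiv> Pi\<^sub>M {1..k} (\<lambda>_. leb01)"
    and "Q \<equiv> Pi\<^sub>M {1..k} (\<lambda>_. lborel) \<Otimes>\<^sub>M Pi\<^sub>M {1..k} (\<lambda>_. lborel)"
    and "A \<equiv> \<lambda>x (s, t). fdd_char2 M D E k x s t * complex_of_real (\<Prod>j=1..k. g (s j) * g (t j))"
  shows integrable_fdd_char2_weight: "\<And>x. x \<in> space P \<Longrightarrow> integrable Q (A x)"
    and integrable_integral_fdd_char2: "integrable P (\<lambda>x. integral\<^sup>L Q (A x))"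
    and integral_fdd_char2: "(\<integral>x. integral\<^sup>L Q (A x) \<partial>P) = (\<integral>\<omega>. path_integral g D E \<omega> ^ k \<partial>M)"
proof -
  interpret L: prob_space leb01 by (rule prob_space_leb01)
  interpret PL: product_prob_space "\<lambda>_::nat. leb01" "{1..k}" ..
  interpret PP: product_sigma_finite "\<lambda>_::nat. lborel :: real measure" ..
  interpret P: prob_space P unfolding P_def by (rule PL.P.prob_space_axioms)
  have Q: "sigma_finite_measure Q"
  proof -
    interpret R: sigma_finite_measure "Pi\<^sub>M {1..k} (\<lambda>_. lborel :: real measure)"
      by (rule PP.sigma_finite) simp
    interpret RR: pair_sigma_finite "Pi\<^sub>M {1..k} (\<lambda>_. lborel :: real measure)" "Pi\<^sub>M {1..k} (\<lambda>_. lborel :: real measure)" ..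
    show ?thesis unfolding Q_def by (rule RR.P.sigma_finite_measure_axioms)
  qed
  have g: "integrable lborel g" using g_int by (rule integrable.intros)
  have [measurable]: "weight_char g \<in> borel_measurable borel"
    using g by (intro borel_measurable_weight_char) auto
  define G :: "(nat \<Rightarrow> real) \<times> (nat \<Rightarrow> real) \<Rightarrow> complex"
    where "G = (\<lambda>(s, t). complex_of_real (\<Prod>j=1..k. g (s j) * g (t j)))"
  \<comment> \<open>With all path values 0 the exponential is 1 and only the weight remains.\<close>
  have G: "integrable Q G"
    using integrable_iexp_weight[OF _ g, of "{1..k}" "\<lambda>_. 0" "\<lambda>_. 0"] by (simp add: G_def Q_def)
  define W where "W x = (\<lambda>(q :: (nat \<Rightarrow> real) \<times> (nat \<Rightarrow> real), \<omega>).
    iexp (\<Sum>j=1..k. fst q j * D \<omega> (x j) + snd q j * E \<omega> (x j)))" for x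
  \<comment> \<open>The sections of \<open>D\<close> and \<open>E\<close> are known to be measurable
    only at points of [0,1], whence the restriction to \<open>space P\<close>.\<close>
  have W_meas: "W x \<in> borel_measurable (Q \<Otimes>\<^sub>M M)" if "x \<in> space P" for x
  proof -
    have x: "x j \<in> space leb01" if "j \<in> {1..k}" for j
      using \<open>x \<in> space P\<close> that by (auto simp: P_def space_PiM)
    have [measurable]: "(\<lambda>\<omega>. D \<omega> (x j)) \<in> borel_measurable M" "(\<lambda>\<omega>. E \<omega> (x j)) \<in> borel_measurable M"
      if "j \<in> {1..k}" for j
      using measurable_compose[OF measurable_Pair2'[OF x[OF that]] D]
        measurable_compose[OF measurable_Pair2'[OF x[OF that]] E] by simp_all
    have [measurable]: "(\<lambda>q. fst q j) \<in> borel_measurable Q" "(\<lambda>q. snd q j) \<in> borel_measurable Q"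
      if "j \<in> {1..k}" for j
      using that unfolding Q_def by measurable
    show ?thesis
      unfolding W_def by measurable
  qed
  have A_eq: "A x = (\<lambda>q. (\<integral>\<omega>. W x (q, \<omega>) \<partial>M) * G q)" for x
    by (auto simp: A_def W_def G_def fdd_char2_def fun_eq_iff)
  have W_bound: "norm (W x (q, \<omega>)) \<le> 1" for x q \<omega>
    by (auto simp: W_def)
  note swap = Fubini_bounded_kernel[OF Q G W_meas W_bound]
  show "integrable Q (A x)" if "x \<in> space P" for x
    unfolding A_eq by (rule swap(1)[OF that])
  define V where "V = (\<lambda>(x :: nat \<Rightarrow> real, \<omega>). \<Prod>j=1..k. weight_char g (D \<omega> (x j)) * weight_char g (E \<omega> (x j)))"
  \<comment> \<open>The factor 1 is the constant weight \<open>G\<close> of the second exchange,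
    \<open>swap2\<close>.\<close>
  have IA: "integral\<^sup>L Q (A x) = (\<integral>\<omega>. V (x, \<omega>) \<partial>M) * 1" if "x \<in> space P" for x
  proof -
    have "(\<integral>q. W x (q, \<omega>) * G q \<partial>Q) = V (x, \<omega>)" for \<omega>
      using integral_iexp_weight[OF _ g, of "{1..k}" "\<lambda>j. D \<omega> (x j)" "\<lambda>j. E \<omega> (x j)"]
      by (simp add: W_def G_def V_def Q_def case_prod_unfold)
    then show ?thesis
      unfolding A_eq swap(2)[OF that] by simp
  qed
  have V_meas: "V \<in> borel_measurable (P \<Otimes>\<^sub>M M)"
  proof -
    \<comment> \<open>The evaluation points now vary, so the joint measurability of \<open>D\<close>
      and \<open>E\<close> is pulled back along this map instead of using sections.\<close>
    have "(\<lambda>z. (snd z, fst z j)) \<in> P \<Otimes>\<^sub>M M \<rightarrow>\<^sub>M M \<Otimes>\<^sub>M leb01" if "j \<in> {1..k}" for j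
      using that unfolding P_def by measurable
    from measurable_compose[OF this D] measurable_compose[OF this E]
    have [measurable]: "(\<lambda>z. D (snd z) (fst z j)) \<in> borel_measurable (P \<Otimes>\<^sub>M M)"
      "(\<lambda>z. E (snd z) (fst z j)) \<in> borel_measurable (P \<Otimes>\<^sub>M M)" if "j \<in> {1..k}" for j
      using that by simp_all
    show ?thesis
      unfolding V_def case_prod_unfold by measurable
  qed
  have le: "norm (weight_char g u) \<le> 1" for u
    using g_pos g_int by (rule norm_weight_char_le)
  have V_bound: "norm (V (x, \<omega>)) \<le> 1" for x \<omega>
    by (auto simp: V_def prod_norm[symmetric] norm_mult intro!: prod_le_1 mult_le_one le)
  have one: "integrable P (\<lambda>_. 1 :: complex)" by simp
  note swap2 = Fubini_bounded_kernel[OF P.sigma_finite_measure_axioms one V_meas V_bound]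
  show "integrable P (\<lambda>x. integral\<^sup>L Q (A x))"
    using swap2(1) by (simp add: IA cong: Bochner_Integration.integrable_cong)
  have V_int: "(\<integral>x. V (x, \<omega>) * 1 \<partial>P) = path_integral g D E \<omega> ^ k" if "\<omega> \<in> space M" for \<omega>
  proof -
    have [measurable]: "(\<lambda>x. D \<omega> x) \<in> borel_measurable leb01" "(\<lambda>x. E \<omega> x) \<in> borel_measurable leb01"
      using measurable_compose[OF measurable_Pair1'[OF that] D]
        measurable_compose[OF measurable_Pair1'[OF that] E] by simp_all
    have "integrable leb01 (\<lambda>x. weight_char g (D \<omega> x) * weight_char g (E \<omega> x))"
      by (rule L.integrable_const_bound[where B = 1]) (auto simp: norm_mult intro!: mult_le_one le)
    then show ?thesis
      using PL.product_integral_prod[of "{1..k}" "\<lambda>_ x. weight_char g (D \<omega> x) * weight_char g (E \<omega> x)"]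
      by (simp add: V_def P_def path_integral_def)
  qed
  have "(\<integral>x. integral\<^sup>L Q (A x) \<partial>P) = (\<integral>x. (\<integral>\<omega>. V (x, \<omega>) \<partial>M) * 1 \<partial>P)"
    by (rule Bochner_Integration.integral_cong) (simp_all add: IA)
  also have "\<dots> = (\<integral>\<omega>. path_integral g D E \<omega> ^ k \<partial>M)"
    unfolding swap2(2) using V_int by (intro Bochner_Integration.integral_cong) simp_all
  finally show "(\<integral>x. integral\<^sup>L Q (A x) \<partial>P) = (\<integral>\<omega>. path_integral g D E \<omega> ^ k \<partial>M)" .
qed

section \<open>Expectation of the exponential series\<close>

text \<open>The terms of the exponential series are dominated by the summable constants 1/k!, which
  justifies termwise integration. The subtracted 1 is the term of index 0, absent because the series
  of the distance covariance starts at 1.\<close>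

lemma (in prob_space) expectation_exp_sums:
  fixes Z :: "'a \<Rightarrow> complex"
  assumes [measurable]: "Z \<in> borel_measurable M" and bound: "\<And>\<omega>. norm (Z \<omega>) \<le> 1"
  shows "(\<lambda>k. (\<integral>\<omega>. Z \<omega> ^ Suc k \<partial>M) / fact (Suc k)) sums ((\<integral>\<omega>. exp (Z \<omega>) \<partial>M) - 1)"
proof -
  define f where "f k \<omega> = Z \<omega> ^ k /\<^sub>R fact k" for k \<omega>
  have f_le: "norm (f k \<omega>) \<le> inverse (fact k)" for k \<omega>
    using power_le_one[OF norm_ge_zero bound, of \<omega> k]
    by (simp add: f_def norm_power mult_left_le_one_le divide_simps)
  have [measurable]: "f k \<in> borel_measurable M" for k
    unfolding f_def[abs_def] by measurable
  have f_int: "integrable M (f k)" for k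
    using f_le by (intro integrable_const_bound[where B = "inverse (fact k)"]) auto
  have sum_fact: "summable (\<lambda>k. inverse (fact k) :: real)"
    using summable_exp[of "1::real"] by simp
  have "summable (\<lambda>k. \<integral>\<omega>. norm (f k \<omega>) \<partial>M)"
  proof (rule summable_comparison_test[OF _ sum_fact], intro exI allI impI)
    fix k
    have "(\<integral>\<omega>. norm (f k \<omega>) \<partial>M) \<le> inverse (fact k)"
      using f_le f_int by (intro integral_le_const) auto
    then show "norm (\<integral>\<omega>. norm (f k \<omega>) \<partial>M) \<le> inverse (fact k)"
      by simp
  qed
  then have "(\<lambda>k. integral\<^sup>L M (f k)) sums (\<integral>\<omega>. (\<Sum>k. f k \<omega>) \<partial>M)"
    using f_int f_le by (intro sums_integral) (auto intro!: summable_comparison_test[OF _ sum_fact])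
  then have "(\<lambda>k. integral\<^sup>L M (f k)) sums (\<integral>\<omega>. exp (Z \<omega>) \<partial>M)"
    by (simp add: f_def exp_def)
  then have "(\<lambda>k. integral\<^sup>L M (f (Suc k))) sums ((\<integral>\<omega>. exp (Z \<omega>) \<partial>M) - integral\<^sup>L M (f 0))"
    by (subst sums_Suc_iff) simp
  moreover have "integral\<^sup>L M (f 0) = 1"
    by (simp add: f_def[abs_def] prob_space)
  moreover have "integral\<^sup>L M (f k) = (\<integral>\<omega>. Z \<omega> ^ k \<partial>M) / fact k" for k
    by (simp add: f_def[abs_def] scaleR_conv_of_real divide_inverse mult.commute)
  ultimately show ?thesis by simp
qed


section \<open>Independent copies\<close>

text \<open>Functions of independent variables are independent, and the bounds make them integrable,
  so the expectation is multiplicative. The list indexing matches the way independence of the three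
  pairs is stated in the theorem.\<close>

lemma (in prob_space) expectation_indep3:
  fixes f1 f2 f3 :: "'b \<Rightarrow> complex"
  assumes indep: "indep_vars (\<lambda>_. N) (\<lambda>i \<omega>. [U \<omega>, V \<omega>, W \<omega>] ! i) {..<3::nat}"
    and meas: "f1 \<in> borel_measurable N" "f2 \<in> borel_measurable N" "f3 \<in> borel_measurable N"
    and bound: "\<And>p. norm (f1 p) \<le> 1" "\<And>p. norm (f2 p) \<le> 1" "\<And>p. norm (f3 p) \<le> 1"
  shows "(\<integral>\<omega>. f1 (U \<omega>) * f2 (V \<omega>) * f3 (W \<omega>) \<partial>M) =
    (\<integral>\<omega>. f1 (U \<omega>) \<partial>M) * (\<integral>\<omega>. f2 (V \<omega>) \<partial>M) * (\<integral>\<omega>. f3 (W \<omega>) \<partial>M)"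
proof -
  have three: "{..<3} = {0, 1, 2 :: nat}" by auto
  have indep': "indep_vars (\<lambda>_. borel) (\<lambda>i \<omega>. ([f1, f2, f3] ! i) ([U \<omega>, V \<omega>, W \<omega>] ! i)) {..<3::nat}"
    by (rule indep_vars_compose2[OF indep]) (auto simp: three meas)
  have "integrable M (\<lambda>\<omega>. ([f1, f2, f3] ! i) ([U \<omega>, V \<omega>, W \<omega>] ! i))" if "i \<in> {..<3}" for i
  proof (rule integrable_const_bound[where B = 1])
    show "(\<lambda>\<omega>. ([f1, f2, f3] ! i) ([U \<omega>, V \<omega>, W \<omega>] ! i)) \<in> borel_measurable M"
      using indep' that by (auto simp: indep_vars_def)
  qed (use that bound in \<open>auto simp: three\<close>)
  from indep_vars_lebesgue_integral[OF _ indep' this] show ?thesis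
    by (simp add: three mult.assoc)
qed

text \<open>With a, b, c for the characteristic functions of (X,Y), X and Y, the left side is |a -
  bc|^2 = |a|^2 + |b|^2 |c|^2 - a conj(bc) - conj(a conj(bc)). Each product is an expectation over
  independent copies, a conjugate factor coming from a subtracted path.\<close>

lemma (in prob_space) fdd_char2_decomp:
  fixes X Y X' Y' Y'' Y''' :: "'a \<Rightarrow> real \<Rightarrow> real"
  assumes ev: "\<And>x. x \<in> {0..1} \<Longrightarrow> (\<lambda>f. f x) \<in> borel_measurable S"
    and meas: "X \<in> M \<rightarrow>\<^sub>M S" "Y \<in> M \<rightarrow>\<^sub>M S" "X' \<in> M \<rightarrow>\<^sub>M S" "Y' \<in> M \<rightarrow>\<^sub>M S"
      "Y'' \<in> M \<rightarrow>\<^sub>M S" "Y''' \<in> M \<rightarrow>\<^sub>M S"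
    and copy: "distr M (S \<Otimes>\<^sub>M S) (\<lambda>\<omega>. (X' \<omega>, Y' \<omega>)) = distr M (S \<Otimes>\<^sub>M S) (\<lambda>\<omega>. (X \<omega>, Y \<omega>))"
      "distr M S Y'' = distr M S Y" "distr M S Y''' = distr M S Y"
    and indep: "indep_vars (\<lambda>_. S \<Otimes>\<^sub>M S)
      (\<lambda>i \<omega>. [(X \<omega>, Y \<omega>), (X' \<omega>, Y' \<omega>), (Y'' \<omega>, Y''' \<omega>)] ! i) {..<3::nat}"
    and indepY: "indep_var S Y'' S Y'''"
    and x: "\<And>j. j \<in> {1..k} \<Longrightarrow> x j \<in> {0..1}"
  defines "diff \<equiv> \<lambda>U V (\<omega>::'a) (x::real). U \<omega> x - V \<omega> x :: real"
  shows "complex_of_real ((cmod (fdd_char2 M X Y k x s t - fdd_char M X k x s * fdd_char M Y k x t))\<^sup>2) =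
      fdd_char2 M (diff X X') (diff Y Y') k x s t
    + fdd_char2 M (diff X X') (diff Y'' Y''') k x s t
    - fdd_char2 M (diff X X') (diff Y Y'') k x s t
    - cnj (fdd_char2 M (diff X X') (diff Y Y'') k x s t)"
proof -
  note meas[measurable]
  define e where "e s p = iexp (\<Sum>j=1..k. s j * p (x j))" for s p :: "_ \<Rightarrow> real"
  have [measurable]: "(\<lambda>p. p (x j)) \<in> borel_measurable S" if "j \<in> {1..k}" for j
    using ev x that by auto
  have e[measurable]: "e s \<in> borel_measurable S" for s
    unfolding e_def[abs_def] by measurable
  have norm_e[simp]: "norm (e s p) = 1" for s p
    by (simp add: e_def)
  \<comment> \<open>This separates a path from the one subtracted from it, so that independence can
    be applied.\<close>
  have e_diff: "e s (\<lambda>x. p x - q x) = e s p * cnj (e s q)" for s p q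
    by (simp add: e_def exp_cnj exp_add[symmetric] sum_subtractf right_diff_distrib)
  have char: "fdd_char M U k x s = (\<integral>\<omega>. e s (U \<omega>) \<partial>M)" for U s
    by (simp add: fdd_char_def e_def)
  have char2: "fdd_char2 M U V k x s t = (\<integral>\<omega>. e s (U \<omega>) * e t (V \<omega>) \<partial>M)" for U V s t
    by (simp add: fdd_char2_def e_def sum.distrib ring_distribs exp_add)
  define f where "f s t = (\<lambda>(p, q). e s p * e t q)" for s t
  have f[measurable]: "f s t \<in> borel_measurable (S \<Otimes>\<^sub>M S)" for s t
    unfolding f_def by measurable
  have cnj_e[measurable]: "(\<lambda>p. cnj (e s p)) \<in> borel_measurable S" for s
    by (rule measurable_compose[OF e borel_measurable_continuous_onI[OF continuous_on_cnj[OF continuous_on_id]]])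
  have cnj_f[measurable]: "(\<lambda>p. cnj (f s t p)) \<in> borel_measurable (S \<Otimes>\<^sub>M S)" for s t
    by (rule measurable_compose[OF f borel_measurable_continuous_onI[OF continuous_on_cnj[OF continuous_on_id]]])
  have norm_f[simp]: "norm (f s t p) = 1" for s t p
    by (cases p) (simp add: f_def norm_mult)
  have XY': "(\<integral>\<omega>. F (X' \<omega>, Y' \<omega>) \<partial>M) = (\<integral>\<omega>. F (X \<omega>, Y \<omega>) \<partial>M)"
    if [measurable]: "F \<in> borel_measurable (S \<Otimes>\<^sub>M S)" for F :: "_ \<Rightarrow> complex"
    using arg_cong[OF copy(1), of "\<lambda>N. integral\<^sup>L N F"] by (simp add: integral_distr)
  have X': "(\<integral>\<omega>. e s (X' \<omega>) \<partial>M) = (\<integral>\<omega>. e s (X \<omega>) \<partial>M)" for s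
    using XY'[of "\<lambda>p. e s (fst p)"] by simp
  have Y'': "(\<integral>\<omega>. e s (Y'' \<omega>) \<partial>M) = (\<integral>\<omega>. e s (Y \<omega>) \<partial>M)" for s
    using arg_cong[OF copy(2), of "\<lambda>N. integral\<^sup>L N (e s)"] by (simp add: integral_distr)
  have Y''': "(\<integral>\<omega>. e s (Y''' \<omega>) \<partial>M) = (\<integral>\<omega>. e s (Y \<omega>) \<partial>M)" for s
    using arg_cong[OF copy(3), of "\<lambda>N. integral\<^sup>L N (e s)"] by (simp add: integral_distr)
  note indep3 = expectation_indep3[OF indep]
  define a b c where "a = fdd_char2 M X Y k x s t" "b = fdd_char M X k x s" "c = fdd_char M Y k x t"
  have 1: "fdd_char2 M (diff X X') (diff Y Y') k x s t = a * cnj a"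
  proof -
    \<comment> \<open>The pair (Y'', Y''') does not occur and contributes the constant factor
      1.\<close>
    have "fdd_char2 M (diff X X') (diff Y Y') k x s t =
      (\<integral>\<omega>. f s t (X \<omega>, Y \<omega>) * cnj (f s t (X' \<omega>, Y' \<omega>)) * 1 \<partial>M)"
      by (simp add: char2 diff_def e_diff f_def mult_ac)
    also have "\<dots> = (\<integral>\<omega>. f s t (X \<omega>, Y \<omega>) \<partial>M) * cnj (\<integral>\<omega>. f s t (X \<omega>, Y \<omega>) \<partial>M)"
      by (subst indep3) (simp_all add: XY' prob_space)
    also have "(\<integral>\<omega>. f s t (X \<omega>, Y \<omega>) \<partial>M) = a"
      by (simp add: a_b_c_def char2 f_def)
    finally show ?thesis .
  qed
  have 2: "fdd_char2 M (diff X X') (diff Y'' Y''') k x s t = b * cnj b * (c * cnj c)"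
  proof -
    have int: "integrable M (\<lambda>\<omega>. e t (Y'' \<omega>))" "integrable M (\<lambda>\<omega>. cnj (e t (Y''' \<omega>)))"
      by (auto intro!: integrable_const_bound[where B = 1])
    have ind: "indep_var borel (\<lambda>\<omega>. e t (Y'' \<omega>)) borel (\<lambda>\<omega>. cnj (e t (Y''' \<omega>)))"
      using indep_var_compose[OF indepY, of "e t" borel "\<lambda>p. cnj (e t p)" borel] by (simp add: comp_def)
    \<comment> \<open>The projections exhibit every factor as a function of one of the three
      independent pairs. Independence of the pairs leaves a factor in (Y'', Y'''), which
      \<open>indepY\<close> then splits.\<close>
    have "fdd_char2 M (diff X X') (diff Y'' Y''') k x s t =
      (\<integral>\<omega>. e s (fst (X \<omega>, Y \<omega>)) * cnj (e s (fst (X' \<omega>, Y' \<omega>))) *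
        (e t (fst (Y'' \<omega>, Y''' \<omega>)) * cnj (e t (snd (Y'' \<omega>, Y''' \<omega>)))) \<partial>M)"
      by (simp add: char2 diff_def e_diff)
    also have "\<dots> = b * cnj b * (\<integral>\<omega>. e t (Y'' \<omega>) * cnj (e t (Y''' \<omega>)) \<partial>M)"
      by (subst indep3) (simp_all add: X' norm_mult a_b_c_def char)
    also have "(\<integral>\<omega>. e t (Y'' \<omega>) * cnj (e t (Y''' \<omega>)) \<partial>M) = c * cnj c"
      by (subst indep_var_lebesgue_integral[OF ind int]) (simp add: Y'' Y''' a_b_c_def char)
    finally show ?thesis .
  qed
  have 3: "fdd_char2 M (diff X X') (diff Y Y'') k x s t = a * cnj b * cnj c"
  proof -
    \<comment> \<open>Here X and Y stay together in one factor and give a, while X' and Y'' come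
      from different pairs and give the conjugates of b and c.\<close>
    have "fdd_char2 M (diff X X') (diff Y Y'') k x s t =
      (\<integral>\<omega>. f s t (X \<omega>, Y \<omega>) * cnj (e s (fst (X' \<omega>, Y' \<omega>))) * cnj (e t (fst (Y'' \<omega>, Y''' \<omega>))) \<partial>M)"
      by (simp add: char2 diff_def e_diff f_def mult_ac)
    also have "\<dots> = (\<integral>\<omega>. f s t (X \<omega>, Y \<omega>) \<partial>M) * cnj b * cnj c"
      by (subst indep3) (simp_all add: X' Y'' a_b_c_def char)
    also have "(\<integral>\<omega>. f s t (X \<omega>, Y \<omega>) \<partial>M) = a"
      by (simp add: a_b_c_def char2 f_def)
    finally show ?thesis .
  qed
  show ?thesis
    unfolding 1 2 3 a_b_c_def[symmetric] complex_norm_square by (simp add: algebra_simps)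
qed

section \<open>From the moments to the formula\<close>

lemma exp_expectation_eq_path_integral:
  "exp_expectation M g U U' V V' =
    (\<integral>\<omega>. exp (path_integral g (\<lambda>\<omega> x. U \<omega> x - U' \<omega> x) (\<lambda>\<omega> x. V \<omega> x - V' \<omega> x) \<omega>) \<partial>M)"
  by (simp add: exp_expectation_def path_integral_def weight_char_def)

theorem lemma2p2:
  fixes M :: "'a measure" and S :: "(real \<Rightarrow> real) measure"
    and X Y X' Y' Y'' Y''' :: "'a \<Rightarrow> real \<Rightarrow> real"
    and g :: "real \<Rightarrow> real"
  assumes "prob_space M"
    and "path_space S"
    and "path_process M S X" and "path_process M S Y"
    and "path_process M S X'" and "path_process M S Y'"
    and "path_process M S Y''" and "path_process M S Y'''"
    and "\<And>s. 0 < g s" and "has_bochner_integral lborel g 1"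
    and "distr M (S \<Otimes>\<^sub>M S) (\<lambda>\<omega>. (X' \<omega>, Y' \<omega>)) = distr M (S \<Otimes>\<^sub>M S) (\<lambda>\<omega>. (X \<omega>, Y \<omega>))"
    and "distr M S Y'' = distr M S Y" and "distr M S Y''' = distr M S Y"
    and "prob_space.indep_vars M (\<lambda>_. S \<Otimes>\<^sub>M S)
           (\<lambda>i \<omega>. [(X \<omega>, Y \<omega>), (X' \<omega>, Y' \<omega>), (Y'' \<omega>, Y''' \<omega>)] ! i) {..<3::nat}"
    and "prob_space.indep_var M S Y'' S Y'''"
  shows "complex_of_real (exp 1 * dcov M g X Y) =
           exp_expectation M g X X' Y Y'
         + exp_expectation M g X X' Y'' Y'''
         - 2 * complex_of_real (Re (exp_expectation M g X X' Y Y''))"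
proof -
  interpret prob_space M by fact
  define diff where "diff = (\<lambda>U V (\<omega>::'a) (x::real). U \<omega> x - V \<omega> x :: real)"
  have meas: "X \<in> M \<rightarrow>\<^sub>M S" "Y \<in> M \<rightarrow>\<^sub>M S" "X' \<in> M \<rightarrow>\<^sub>M S" "Y' \<in> M \<rightarrow>\<^sub>M S"
    "Y'' \<in> M \<rightarrow>\<^sub>M S" "Y''' \<in> M \<rightarrow>\<^sub>M S"
    using assms(3-8) by (auto simp: path_process_def)
  have ev: "(\<lambda>f. f x) \<in> borel_measurable S" if "x \<in> {0..1}" for x
    using \<open>path_space S\<close> that by (auto simp: path_space_def)
  have diff_meas: "(\<lambda>(\<omega>, x). diff U V \<omega> x) \<in> borel_measurable (M \<Otimes>\<^sub>M leb01)"
    if "path_process M S U" "path_process M S V" for U V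
  proof -
    have [measurable]: "(\<lambda>p. U (fst p) (snd p)) \<in> borel_measurable (M \<Otimes>\<^sub>M leb01)"
      "(\<lambda>p. V (fst p) (snd p)) \<in> borel_measurable (M \<Otimes>\<^sub>M leb01)"
      using that by (simp_all add: path_process_def case_prod_unfold)
    show ?thesis
      unfolding diff_def case_prod_unfold by measurable
  qed
  \<comment> \<open>The second differences of the three exponents, in the order of the formula;
    \<open>D\<close> below is the first difference, common to all three.\<close>
  define D1 D2 D3 where "D1 = diff Y Y'" "D2 = diff Y'' Y'''" "D3 = diff Y Y''"
  define D where "D = diff X X'"
  have m: "(\<lambda>(\<omega>, x). D \<omega> x) \<in> borel_measurable (M \<Otimes>\<^sub>M leb01)"
    "(\<lambda>(\<omega>, x). D1 \<omega> x) \<in> borel_measurable (M \<Otimes>\<^sub>M leb01)"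
    "(\<lambda>(\<omega>, x). D2 \<omega> x) \<in> borel_measurable (M \<Otimes>\<^sub>M leb01)"
    "(\<lambda>(\<omega>, x). D3 \<omega> x) \<in> borel_measurable (M \<Otimes>\<^sub>M leb01)"
    unfolding D_def D1_D2_D3_def using assms(3-8) by (auto intro!: diff_meas)
  define C where "C E k = (\<integral>\<omega>. path_integral g D E \<omega> ^ k \<partial>M)" for E k
  have moments: "complex_of_real (dcov_integral M g X Y k) = C D1 k + C D2 k - C D3 k - cnj (C D3 k)" for k
  proof -
    define P where "P = Pi\<^sub>M {1..k} (\<lambda>_. leb01)"
    define Q :: "((nat \<Rightarrow> real) \<times> (nat \<Rightarrow> real)) measure"
      where "Q = Pi\<^sub>M {1..k} (\<lambda>_. lborel) \<Otimes>\<^sub>M Pi\<^sub>M {1..k} (\<lambda>_. lborel)"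
    define A where "A E x = (\<lambda>(s, t).
      fdd_char2 M D E k x s t * complex_of_real (\<Prod>j=1..k. g (s j) * g (t j)))" for E x
    define R where "R x = (\<lambda>(s, t).
      (cmod (fdd_char2 M X Y k x s t - fdd_char M X k x s * fdd_char M Y k x t))\<^sup>2
        * (\<Prod>j=1..k. g (s j) * g (t j)))" for x
    \<comment> \<open>The weight is real, so multiplying the decomposition by it commutes with
      conjugation.\<close>
    have R: "complex_of_real (R x q) = A D1 x q + A D2 x q - A D3 x q - cnj (A D3 x q)"
      if "x \<in> space P" for x q
    proof -
      have "x j \<in> {0..1}" if "j \<in> {1..k}" for j
        using \<open>x \<in> space P\<close> that by (auto simp: P_def space_PiM space_restrict_space)
      note decomp = fdd_char2_decomp[OF ev meas assms(11-15) this]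
      show ?thesis
        by (cases q) (simp only: R_def A_def D_def D1_D2_D3_def diff_def prod.case of_real_mult decomp complex_cnj_mult
            complex_cnj_complex_of_real, simp add: algebra_simps)
    qed
    note A = integrable_fdd_char2_weight[OF m(1) _ assms(9,10), of _ _ k, folded A_def P_def Q_def]
      integrable_integral_fdd_char2[OF m(1) _ assms(9,10), of _ k, folded A_def P_def Q_def]
      integral_fdd_char2[OF m(1) _ assms(9,10), of _ k, folded A_def P_def Q_def C_def]
    have "complex_of_real (dcov_integral M g X Y k) = (\<integral>x. (\<integral>q. complex_of_real (R x q) \<partial>Q) \<partial>P)"
      by (simp add: dcov_integral_def R_def P_def Q_def)
    also have "\<dots> = (\<integral>x. integral\<^sup>L Q (A D1 x) + integral\<^sup>L Q (A D2 x) - integral\<^sup>L Q (A D3 x)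
        - cnj (integral\<^sup>L Q (A D3 x)) \<partial>P)"
      using A(1) m by (intro Bochner_Integration.integral_cong) (simp_all add: R)
    also have "\<dots> = C D1 k + C D2 k - C D3 k - cnj (C D3 k)"
      using A(2,3) m by simp
    finally show ?thesis .
  qed
  define E where "E V = (\<integral>\<omega>. exp (path_integral g D V \<omega>) \<partial>M)" for V
  have C_sums: "(\<lambda>k. C V (Suc k) / fact (Suc k)) sums (E V - 1)"
    if "(\<lambda>(\<omega>, x). V \<omega> x) \<in> borel_measurable (M \<Otimes>\<^sub>M leb01)" for V
    unfolding C_def E_def
    using borel_measurable_path_integral[OF m(1) that assms(9,10)]
      norm_path_integral_le[OF m(1) that assms(9,10)] by (rule expectation_exp_sums)
  define L where "L = (E D1 - 1) + (E D2 - 1) - (E D3 - 1) - cnj (E D3 - 1)"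
  \<comment> \<open>The constants from the missing terms of index 0 cancel, and a number plus its
    conjugate is twice its real part.\<close>
  have L_eq: "L = E D1 + E D2 - 2 * complex_of_real (Re (E D3))"
    by (simp add: L_def complex_eq_iff)
  have "(\<lambda>k. C D1 (Suc k) / fact (Suc k) + C D2 (Suc k) / fact (Suc k) - C D3 (Suc k) / fact (Suc k)
      - cnj (C D3 (Suc k) / fact (Suc k))) sums L"
    unfolding L_def by (intro sums_add sums_diff C_sums m sums_cnj[THEN iffD2])
  moreover have "C D1 k / fact k + C D2 k / fact k - C D3 k / fact k - cnj (C D3 k / fact k) =
      complex_of_real (dcov_integral M g X Y k / fact k)" for k
    by (simp add: moments add_divide_distrib diff_divide_distrib)
  ultimately have sums: "(\<lambda>k. complex_of_real (dcov_integral M g X Y (Suc k) / fact (Suc k))) sums L"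
    by (simp only:)
  \<comment> \<open>Neither \<open>E D1\<close> nor \<open>E D2\<close> has been shown to be real
    separately; \<open>L\<close> is real as the sum of a series of real terms.\<close>
  have "Im L = 0"
    using sums_unique[OF sums_Im[OF sums]] by (simp only: Im_complex_of_real suminf_zero)
  then have L_real: "L = complex_of_real (Re L)"
    by (simp add: complex_eq_iff)
  \<comment> \<open>Taking real parts gives convergence of the real series in \<open>dcov\<close>,
    so its \<open>suminf\<close> is a genuine sum.\<close>
  have "(\<lambda>k. exp (- 1) * (dcov_integral M g X Y (Suc k) / fact (Suc k))) sums (exp (- 1) * Re L)"
    using sums_Re[OF sums] by (intro sums_mult) (simp only: Re_complex_of_real)
  then have "dcov M g X Y = exp (- 1) * Re L"
    by (simp add: dcov_def sums_unique[symmetric])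
  then have "complex_of_real (exp 1 * dcov M g X Y) = L"
    using L_real by (simp add: exp_minus)
  then show ?thesis
    by (simp add: L_eq E_def D_def D1_D2_D3_def diff_def exp_expectation_eq_path_integral)
qed

end
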